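(* Let $\lambda\in\mathbb{C}$ with $\lambda\neq1$. For all non-negative integers $a,b$ and all $n\in\mathbb{N}$ (that is, $n\ge1$), $$\sum_{j=0}^{an}\binom{an}{j}(-\lambda)^{an-j}H_{n-1}^{(an)}(x+j|\lambda)=(1-\lambda)^{an}(n-1)!\sum_{j=0}^{n-1}\frac{(bn)!}{(j+bn)!\,(n-j-1)!}\,S_2(j+bn,bn)\,B_{n-1-j}^{(bn)}(x).$$
   Context: All generating functions are formal power series in $t$. The Frobenius-Euler polynomials of order $\alpha$ are defined by $\left(\frac{1-\lambda}{e^t-\lambda}\right)^{\alpha}e^{xt}=\sum_{n\ge0}H_n^{(\alpha)}(x|\lambda)\frac{t^n}{n!}$. The Bernoulli polynomials of order $\alpha$ are defined by $\left(\frac{t}{e^t-1}\right)^{\alpha}e^{xt}=\sum_{n\ge0}B_n^{(\alpha)}(x)\frac{t^n}{n!}$. The Stirling numbers of the second kind $S_2(l,n)$ are defined by $(e^t-1)^n=n!\sum_{l=n}^{\infty}S_2(l,n)\frac{t^l}{l!}$. Convention: $(-\lambda)^0=1$. *)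

theory Defs
  imports
    Complex_Main
    "HOL-Computational_Algebra.Formal_Power_Series"
    "HOL-Combinatorics.Stirling"
begin

text \<open>
  The families below are given as values at a complex number \<open>x\<close>, read off from their exponential
  generating functions (whence the factor \<open>fact n\<close>). Only orders that are natural numbers occur,
  so the order is an ordinary exponent.
\<close>

definition frobenius_euler :: "nat \<Rightarrow> complex \<Rightarrow> nat \<Rightarrow> complex \<Rightarrow> complex" where
  "frobenius_euler \<alpha> lam n x =
     fact n * fps_nth ((fps_const (1 - lam) / (fps_exp 1 - fps_const lam)) ^ \<alpha> * fps_exp x) n"

text \<open>
  The denominator \<open>fps_exp 1 - 1\<close> has subdegree 1 and is not a unit, but neither is \<open>fps_X\<close>: the
  quotient is exact.
\<close>

definition bernoulli_order :: "nat \<Rightarrow> nat \<Rightarrow> complex \<Rightarrow> complex" where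
  "bernoulli_order \<alpha> n x =
     fact n * fps_nth ((fps_X / (fps_exp 1 - 1)) ^ \<alpha> * fps_exp x) n"

lemma frobenius_euler_egf:
  "Abs_fps (\<lambda>n. frobenius_euler \<alpha> lam n x / fact n) =
     (fps_const (1 - lam) / (fps_exp 1 - fps_const lam)) ^ \<alpha> * fps_exp x"
  by (simp add: fps_eq_iff frobenius_euler_def)

lemma bernoulli_order_egf:
  "Abs_fps (\<lambda>n. bernoulli_order \<alpha> n x / fact n) = (fps_X / (fps_exp 1 - 1)) ^ \<alpha> * fps_exp x"
  by (simp add: fps_eq_iff bernoulli_order_def)

lemma frobenius_euler_quotient:
  fixes lam :: complex
  assumes "lam \<noteq> 1"
  shows "fps_const (1 - lam) / (fps_exp 1 - fps_const lam) * (fps_exp 1 - fps_const lam) = fps_const (1 - lam)"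
proof -
  have "fps_nth (fps_exp 1 - fps_const lam) 0 \<noteq> 0"
    using assms by simp
  then have "is_unit (fps_exp 1 - fps_const lam)"
    by (simp only: fps_is_unit_iff not_False_eq_True)
  then show ?thesis
    by (rule dvd_div_mult_self [OF unit_imp_dvd])
qed

lemma bernoulli_quotient:
  "fps_X / (fps_exp 1 - 1) * (fps_exp 1 - 1) = (fps_X :: complex fps)"
proof (rule dvd_div_mult_self)
  have "subdegree (fps_exp 1 - 1 :: complex fps) = 1"
    by (rule subdegreeI) auto
  then show "(fps_exp 1 - 1 :: complex fps) dvd fps_X"
    by (subst fps_dvd_iff) auto
qed

text \<open>
  The library's \<open>Stirling\<close> is defined by the triangular recurrence; it agrees with the
  definition by generating function.
\<close>

lemma Stirling_egf:
  "(fps_exp 1 - 1 :: complex fps) ^ n =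
     fps_const (fact n) * Abs_fps (\<lambda>l. if n \<le> l then of_nat (Stirling l n) / fact l else 0)"
proof -
  let ?E = "fps_exp 1 - 1 :: complex fps"
  have "fps_nth (?E ^ n) l = fact n * of_nat (Stirling l n) / fact l" for l
  proof (induction l arbitrary: n)
    case 0
    then show ?case by (cases n) (simp_all add: fps_power_zeroth)
  next
    case (Suc l)
    show ?case
    proof (cases n)
      case 0
      then show ?thesis by simp
    next
      case (Suc m)
      have "fps_deriv (?E ^ Suc m) = fps_const (of_nat (Suc m)) * (fps_exp 1 * ?E ^ m)"
        by (subst fps_deriv_power) (simp add: mult.assoc)
      also have "fps_exp 1 * ?E ^ m = ?E ^ Suc m + ?E ^ m"
        by (simp add: algebra_simps)
      finally have "fps_nth (fps_deriv (?E ^ Suc m)) l =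
          of_nat (Suc m) * (fps_nth (?E ^ Suc m) l + fps_nth (?E ^ m) l)"
        by (simp only: fps_mult_left_const_nth fps_add_nth)
      then have "of_nat (Suc l) * fps_nth (?E ^ Suc m) (Suc l) =
          of_nat (Suc m) * (fact (Suc m) * of_nat (Stirling l (Suc m)) / fact l
            + fact m * of_nat (Stirling l m) / fact l)"
        unfolding Suc.IH fps_deriv_nth by (simp only: Suc_eq_plus1)
      also have "\<dots> = fact (Suc m) * of_nat (Stirling (Suc l) (Suc m)) / fact l"
        by (simp add: add_divide_distrib algebra_simps)
      finally have *: "of_nat (Suc l) * fps_nth (?E ^ Suc m) (Suc l) =
          fact (Suc m) * of_nat (Stirling (Suc l) (Suc m)) / (fact l :: complex)" .
      have nz: "of_nat (Suc l) \<noteq> (0 :: complex)"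
        by (rule of_nat_neq_0)
      have "of_nat (Suc l) * fps_nth (?E ^ Suc m) (Suc l) =
          of_nat (Suc l) * (fact (Suc m) * of_nat (Stirling (Suc l) (Suc m)) / fact (Suc l))"
        unfolding * fact_Suc [of l] using nz by (simp del: of_nat_Suc fact_Suc Stirling.simps)
      then show ?thesis
        using \<open>n = Suc m\<close> by (simp only: mult_left_cancel [OF nz])
    qed
  qed
  then show ?thesis
    by (auto simp: fps_eq_iff)
qed

end

theory Submission
  imports Defs
begin

text \<open>
  Both sides equal \<open>(1 - lam) ^ (a * n) * x ^ (n - 1)\<close>; in particular neither sum remembers its
  order beyond the factor \<open>(1 - lam) ^ (a * n)\<close>, which is why \<open>a\<close> and \<open>b\<close> are unrelated.

  On the left, shifting the argument by \<open>j\<close> multiplies the generating function by \<open>e\<^sup>j\<^sup>t\<close>, so the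
  binomial sum multiplies it by \<open>(e\<^sup>t - lam)\<close> to the power \<open>a * n\<close>. This is exactly the denominator
  of the Frobenius-Euler generating function of that order, and only
  \<open>(1 - lam) ^ (a * n) * e\<^sup>x\<^sup>t\<close> is left (\<open>frobenius_euler_binomial_sum\<close>).

  On the right, the sum is a Cauchy product. The Stirling numbers contribute
  \<open>((e\<^sup>t - 1) / t)\<close> to the power \<open>b * n\<close>, the Bernoulli polynomials the inverse of that power times
  \<open>e\<^sup>x\<^sup>t\<close>, and again only \<open>e\<^sup>x\<^sup>t\<close> survives (\<open>Stirling_bernoulli_order_sum\<close>).
\<close>

lemma binomial_sum_fps_exp:
  fixes c :: complex
  shows "(\<Sum>j=0..N. fps_const (of_nat (N choose j) * (- c) ^ (N - j)) * fps_exp (of_nat j))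
    = (fps_exp 1 - fps_const c) ^ N"
proof -
  have "(fps_exp 1 - fps_const c) ^ N = (fps_exp 1 + fps_const (- c)) ^ N"
    by (simp flip: fps_const_neg)
  also have "\<dots> = (\<Sum>j\<le>N. of_nat (N choose j) * fps_exp 1 ^ j * fps_const (- c) ^ (N - j))"
    by (rule binomial_ring)
  also have "\<dots> = (\<Sum>j=0..N. fps_const (of_nat (N choose j) * (- c) ^ (N - j)) * fps_exp (of_nat j))"
    unfolding atLeast0AtMost
    by (rule sum.cong)
      (simp_all only: flip: fps_const_mult fps_const_power fps_of_nat,
        simp_all add: fps_exp_power_mult mult_ac)
  finally show ?thesis ..
qed

text \<open>
  The binomial sum applies the operator \<open>(e\<^sup>D - lam) ^ N\<close> in \<open>x\<close> (with \<open>e\<^sup>D\<close> the unit shift), and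
  the Frobenius-Euler polynomials of order \<open>N\<close> are the preimages of the scaled monomials under it.
\<close>

lemma frobenius_euler_binomial_sum:
  fixes lam x :: complex
  assumes "lam \<noteq> 1"
  shows "(\<Sum>j=0..N. of_nat (N choose j) * (- lam) ^ (N - j) * frobenius_euler N lam m (x + of_nat j))
    = (1 - lam) ^ N * x ^ m"
proof -
  let ?F = "fps_const (1 - lam) / (fps_exp 1 - fps_const lam)"
  let ?c = "\<lambda>j. of_nat (N choose j) * (- lam) ^ (N - j)"
  have "(\<Sum>j=0..N. fps_const (?c j) * (?F ^ N * fps_exp (x + of_nat j)))
      = ?F ^ N * fps_exp x * (\<Sum>j=0..N. fps_const (?c j) * fps_exp (of_nat j))"
    by (simp only: fps_exp_add_mult sum_distrib_left mult.assoc mult.commute mult.left_commute)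
  also have "\<dots> = (?F * (fps_exp 1 - fps_const lam)) ^ N * fps_exp x"
    unfolding binomial_sum_fps_exp by (simp only: power_mult_distrib mult.assoc mult.commute mult.left_commute)
  also have "\<dots> = fps_const ((1 - lam) ^ N) * fps_exp x"
    unfolding frobenius_euler_quotient [OF assms] by (simp only: fps_const_power)
  finally have "fps_nth (\<Sum>j=0..N. fps_const (?c j) * (?F ^ N * fps_exp (x + of_nat j))) m
      = fps_nth (fps_const ((1 - lam) ^ N) * fps_exp x) m"
    by (rule arg_cong)
  then have "(\<Sum>j=0..N. ?c j * fps_nth (?F ^ N * fps_exp (x + of_nat j)) m)
      = (1 - lam) ^ N * x ^ m / fact m"
    by (simp only: fps_sum_nth fps_mult_left_const_nth fps_exp_nth times_divide_eq_right
        of_nat_fact)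
  then have "fact m * (\<Sum>j=0..N. ?c j * fps_nth (?F ^ N * fps_exp (x + of_nat j)) m)
      = (1 - lam) ^ N * x ^ m"
    by simp
  then show ?thesis
    unfolding frobenius_euler_def sum_distrib_left by (simp only: mult.left_commute)
qed

text \<open>
  The series \<open>((e\<^sup>t - 1) / t) ^ M\<close> is written as a shift of \<open>(e\<^sup>t - 1) ^ M\<close>, because this makes
  its coefficients Stirling numbers with first index offset by \<open>M\<close>.
\<close>

lemma fps_shift_exp_minus_one_power_nth:
  "fps_nth (fps_shift M ((fps_exp 1 - 1 :: complex fps) ^ M)) j
    = fact M * of_nat (Stirling (j + M) M) / fact (j + M)"
  by (simp add: Stirling_egf)

lemma fps_shift_exp_minus_one_power_mult_bernoulli:
  "fps_shift M ((fps_exp 1 - 1) ^ M) * (fps_X / (fps_exp 1 - 1)) ^ M = (1 :: complex fps)"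
proof -
  let ?E = "fps_exp 1 - 1 :: complex fps"
  have shift: "fps_X ^ M * fps_shift M (?E ^ M) = ?E ^ M"
    by (auto simp: fps_eq_iff fps_X_power_mult_nth Stirling_egf)
  have "fps_X ^ M * (fps_shift M (?E ^ M) * (fps_X / ?E) ^ M)
      = fps_X ^ M * fps_shift M (?E ^ M) * (fps_X / ?E) ^ M"
    by (rule mult.assoc [symmetric])
  also have "\<dots> = (fps_X / ?E * ?E) ^ M"
    unfolding shift power_mult_distrib by (rule mult.commute)
  also have "\<dots> = fps_X ^ M * 1"
    unfolding bernoulli_quotient by simp
  \<comment> \<open>Formal power series over a field have no zero divisors, so \<open>t ^ M\<close> cancels.\<close>
  finally show ?thesis
    by (subst (asm) mult_left_cancel) simp_all
qed

lemma Stirling_bernoulli_order_sum: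
  "fact m * (\<Sum>j=0..m. fact M / (fact (j + M) * fact (m - j))
      * of_nat (Stirling (j + M) M) * bernoulli_order M (m - j) x) = x ^ m"
proof -
  let ?E = "fps_exp 1 - 1 :: complex fps"
  let ?B = "(fps_X / ?E) ^ M * fps_exp x"
  have "(\<Sum>j=0..m. fact M / (fact (j + M) * fact (m - j))
        * of_nat (Stirling (j + M) M) * bernoulli_order M (m - j) x)
      = (\<Sum>j=0..m. fps_nth (fps_shift M (?E ^ M)) j * fps_nth ?B (m - j))"
    unfolding fps_shift_exp_minus_one_power_nth bernoulli_order_def
    by (rule sum.cong) simp_all
  also have "\<dots> = fps_nth (fps_shift M (?E ^ M) * (fps_X / ?E) ^ M * fps_exp x) m"
    unfolding mult.assoc by (rule fps_mult_nth [symmetric])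
  also have "\<dots> = x ^ m / fact m"
    unfolding fps_shift_exp_minus_one_power_mult_bernoulli by simp
  finally show ?thesis
    by simp
qed

theorem theorem5:
  fixes lam x :: complex and a b n :: nat
  assumes "lam \<noteq> 1" and "n \<ge> 1"
  shows "(\<Sum>j=0..a*n. of_nat ((a*n) choose j) * (-lam) ^ (a*n - j)
            * frobenius_euler (a*n) lam (n - 1) (x + of_nat j))
       = (1 - lam) ^ (a*n) * fact (n - 1)
          * (\<Sum>j=0..n-1. fact (b*n) / (fact (j + b*n) * fact (n - j - 1))
               * of_nat (Stirling (j + b*n) (b*n)) * bernoulli_order (b*n) (n - 1 - j) x)"
proof -
  have "n - j - 1 = n - 1 - j" for j
    by simp
  then show ?thesis
    unfolding frobenius_euler_binomial_sum [OF assms(1)] mult.assoc [of "(1 - lam) ^ (a*n)"]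
    by (simp only: Stirling_bernoulli_order_sum)
qed

end
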